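(* Let $a_0,\dots,a_5\in\mathbb{C}$ and let $C_1, C_2$ be the conics in the complex projective plane with tangential equations $$C_1:\ a_0w_1^2+a_2w_2^2+a_4w_3^2+2a_3w_2w_3+2a_5w_1w_3+2a_1w_1w_2=0,\qquad C_2:\ w_2^2-4w_1w_3=0,$$ assumed to be in general position. Let $F(s,x_1,x_2)$ be the point equation, in Darboux coordinates $(x_1,x_2)$ with respect to $C_2$, of the pencil of conics $C_1+sC_2$, that is, $$F(s,x_1,x_2)=\det\begin{pmatrix}0&z_1&z_2&z_3\\ z_1&a_0&a_1&a_5-2s\\ z_2&a_1&a_2+s&a_3\\ z_3&a_5-2s&a_3&a_4\end{pmatrix},\qquad z_1=1,\ z_2=\frac{x_1+x_2}{2},\ z_3=x_1x_2,$$ which is a polynomial of degree two in each of $s,x_1,x_2$, symmetric in $(x_1,x_2)$. Then: (i) There exists a polynomial $P=P(x)$ such that $\mathcal{D}_s(F)(x_1,x_2)=P(x_1)P(x_2)$. (ii) There exists a polynomial $J=J(s)$ such that, with the same $P$, $\mathcal{D}_{x_2}(F)(s,x_1)=J(s)P(x_1)$; and, by the symmetry of $F$, likewise $\mathcal{D}_{x_1}(F)(s,x_2)=J(s)P(x_2)$.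
   Context: $\mathcal{D}_{y}(F)$ denotes the discriminant of $F$ with respect to the variable $y$, a polynomial in the remaining variables; for a polynomial $ay^2+by+c$ of degree two in $y$ it is $b^2-4ac$. General position means that the conics of the pencil $C_1+sC_2$ have four distinct common tangent lines. The Darboux coordinates of a point $(z_1:z_2:z_3)$ with respect to $C_2$ are the two roots $x_1,x_2$ of $z_1\ell^2-2z_2\ell+z_3=0$, which are the parameters of the two tangents to $C_2$ through the point. *)

theory Defs
  imports "HOL-Analysis.Analysis" "HOL-Computational_Algebra.Polynomial"
begin

text \<open>
  A tangential equation is a quadratic form in the line coordinates \<open>w\<close>; the line
  \<open>w\<^sub>1 z\<^sub>1 + w\<^sub>2 z\<^sub>2 + w\<^sub>3 z\<^sub>3 = 0\<close> is tangent to the conic iff the form vanishes at \<open>w\<close>.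
\<close>

definition conic1 ::
  "complex \<Rightarrow> complex \<Rightarrow> complex \<Rightarrow> complex \<Rightarrow> complex \<Rightarrow> complex \<Rightarrow> complex ^ 3 \<Rightarrow> complex" where
  "conic1 a0 a1 a2 a3 a4 a5 w =
     a0 * (w$1)\<^sup>2 + a2 * (w$2)\<^sup>2 + a4 * (w$3)\<^sup>2
     + 2 * a3 * (w$2) * (w$3) + 2 * a5 * (w$1) * (w$3) + 2 * a1 * (w$1) * (w$2)"

definition conic2 :: "complex ^ 3 \<Rightarrow> complex" where
  "conic2 w = (w$2)\<^sup>2 - 4 * (w$1) * (w$3)"

text \<open>
  A projective line with coordinates \<open>w \<noteq> 0\<close> is represented by the one-dimensional complex
  subspace spanned by \<open>w\<close> (\<open>vec.span\<close> is the span over the complex scalars).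
\<close>

definition common_tangents :: "(complex ^ 3 \<Rightarrow> complex) \<Rightarrow> (complex ^ 3 \<Rightarrow> complex) \<Rightarrow> (complex ^ 3) set set"
  where
  "common_tangents q1 q2 = {vec.span {w} | w. w \<noteq> 0 \<and> (\<forall>s. q1 w + s * q2 w = 0)}"

definition general_position :: "(complex ^ 3 \<Rightarrow> complex) \<Rightarrow> (complex ^ 3 \<Rightarrow> complex) \<Rightarrow> bool" where
  "general_position q1 q2 \<longleftrightarrow> card (common_tangents q1 q2) = 4"

text \<open>
  Polynomials in three variables over the complex numbers are elements of
  \<open>complex poly poly poly\<close>. The point equation takes the polynomials to be put for \<open>s\<close>, \<open>x1\<close> and
  \<open>x2\<close> as arguments, so that any of the three can be made the outermost variable, the one with
  respect to which \<open>degree\<close>, \<open>coeff\<close> and the discriminant are taken.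
\<close>

definition const3 :: "complex \<Rightarrow> complex poly poly poly" where
  "const3 c = [:[:[:c:]:]:]"

definition point_equation ::
  "complex \<Rightarrow> complex \<Rightarrow> complex \<Rightarrow> complex \<Rightarrow> complex \<Rightarrow> complex \<Rightarrow>
   complex poly poly poly \<Rightarrow> complex poly poly poly \<Rightarrow> complex poly poly poly \<Rightarrow>
   complex poly poly poly" where
  "point_equation a0 a1 a2 a3 a4 a5 s x1 x2 =
     (let z1 = 1; z2 = const3 (1/2) * (x1 + x2); z3 = x1 * x2 in
      det (vector
        [vector [0,  z1,                 z2,            z3],
         vector [z1, const3 a0,          const3 a1,     const3 a5 - 2 * s],
         vector [z2, const3 a1,          const3 a2 + s, const3 a3],
         vector [z3, const3 a5 - 2 * s,  const3 a3,     const3 a4]]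
        :: complex poly poly poly ^ 4 ^ 4))"

text \<open>The outermost variable, and the two variables of the coefficient ring.\<close>

definition Y :: "complex poly poly poly" where "Y = [:0, 1:]"

definition U :: "complex poly poly" where "U = [:[:0, 1:]:]"

definition V :: "complex poly poly" where "V = [:0, 1:]"

text \<open>The discriminant of a polynomial of degree two.\<close>

definition discriminant2 :: "'a::comm_ring_1 poly \<Rightarrow> 'a" where
  "discriminant2 p = (coeff p 1)\<^sup>2 - 4 * coeff p 2 * coeff p 0"

text \<open>The bivariate polynomial obtained by substituting \<open>x\<close> for the variable of \<open>p\<close>.\<close>

definition subst2 :: "complex poly \<Rightarrow> complex poly poly \<Rightarrow> complex poly poly" where
  "subst2 p x = poly (map_poly (\<lambda>c. [:[:c:]:]) p) x"

end

theory Submission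
  imports Defs
begin

text \<open>
  Let \<open>M\<close> be a symmetric matrix of order three, \<open>T(v, w)\<close> its bilinear form on lines and
  \<open>Q(z, z')\<close> the bilinear form on points whose matrix is the adjugate of \<open>M\<close>. Expanding the bordered
  determinant shows that the point equation is \<open>- Q(z, z)\<close>. Both factorizations of discriminants
  come from one identity for binary Gram determinants (\<open>adj_bilinear_cross\<close>),
  \[ Q(v \times w, v \times w) = T(v, v)\, T(w, w) - T(v, w)^2, \]
  together with its dual (\<open>adj_bilinear_gram\<close>), which is the same identity for the adjugate matrix:
  \[ Q(u, u)\, Q(v, v) - Q(u, v)^2 = \det M \cdot T(u \times v, u \times v). \]

  The tangent to \<open>C\<^sub>2\<close> with parameter \<open>x\<close> has the line coordinates \<open>w(x) = (x\<^sup>2, - 2 x, 1)\<close>. Since the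
  form of \<open>C\<^sub>2\<close> vanishes there, \<open>P(x) = T(w(x), w(x))\<close> is the same for every conic of the pencil: it
  is the form of \<open>C\<^sub>1\<close> restricted to the tangents of \<open>C\<^sub>2\<close>, and its roots are the finite parameters of
  the common tangents.

  For (i), the point with Darboux coordinates \<open>x\<^sub>1, x\<^sub>2\<close> is the intersection of the tangents
  \<open>w(x\<^sub>1)\<close> and \<open>w(x\<^sub>2)\<close>, so \<open>w(x\<^sub>1) \<times> w(x\<^sub>2)\<close> is \<open>2 (x\<^sub>2 - x\<^sub>1)\<close> times \<open>z\<close>. The first identity gives
  \[ 4 (x_1 - x_2)^2 F = T(w(x_1), w(x_2))^2 - P(x_1) P(x_2), \]
  where \<open>T(w(x\<^sub>1), w(x\<^sub>2))\<close> is linear in \<open>s\<close> with leading coefficient \<open>- 2 (x\<^sub>1 - x\<^sub>2)\<^sup>2\<close> and the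
  product \<open>P(x\<^sub>1) P(x\<^sub>2)\<close> does not involve \<open>s\<close>. The discriminant of a square of a linear polynomial
  minus a constant can be read off, and cancelling powers of \<open>x\<^sub>1 - x\<^sub>2\<close> leaves \<open>P(x\<^sub>1) P(x\<^sub>2)\<close>.

  For (ii), with one Darboux coordinate \<open>x\<close> fixed and the other one \<open>y\<close> varying, \<open>z = u + y v\<close> moves
  along the tangent \<open>w(x)\<close>, and \<open>u \<times> v = w(x) / 2\<close>. So the discriminant in \<open>y\<close>, four times the
  negative of a Gram determinant of \<open>Q\<close>, is \<open>- det M \<cdot> P(x)\<close> by the second identity; this yields
  \<open>J = - det M\<close>, a polynomial in \<open>s\<close> that is the same in both Darboux coordinates.
\<close>

section \<open>A conic and its adjugate form\<close>

text \<open>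
  The numbering of the coefficients is the one of \<open>conic1\<close>: the matrix of the form has the rows
  \<open>(a0, a1, a5)\<close>, \<open>(a1, a2, a3)\<close> and \<open>(a5, a3, a4)\<close>. The coefficients range over an arbitrary
  commutative ring because each of \<open>s\<close>, \<open>x1\<close>, \<open>x2\<close> takes its turn as the variable of a polynomial ring
  over the others.
\<close>

definition sym_bilinear ::
  "'a::comm_ring_1 \<Rightarrow> 'a \<Rightarrow> 'a \<Rightarrow> 'a \<Rightarrow> 'a \<Rightarrow> 'a \<Rightarrow> 'a \<times> 'a \<times> 'a \<Rightarrow> 'a \<times> 'a \<times> 'a \<Rightarrow> 'a" where
  "sym_bilinear a0 a1 a2 a3 a4 a5 = (\<lambda>(v1, v2, v3) (w1, w2, w3).
     a0 * v1 * w1 + a2 * v2 * w2 + a4 * v3 * w3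
     + a3 * (v2 * w3 + v3 * w2) + a5 * (v1 * w3 + v3 * w1) + a1 * (v1 * w2 + v2 * w1))"

definition sym_det :: "'a::comm_ring_1 \<Rightarrow> 'a \<Rightarrow> 'a \<Rightarrow> 'a \<Rightarrow> 'a \<Rightarrow> 'a \<Rightarrow> 'a" where
  "sym_det a0 a1 a2 a3 a4 a5 =
     a0 * (a2 * a4 - a3\<^sup>2) + a1 * (a3 * a5 - a1 * a4) + a5 * (a1 * a3 - a2 * a5)"

definition adj_bilinear ::
  "'a::comm_ring_1 \<Rightarrow> 'a \<Rightarrow> 'a \<Rightarrow> 'a \<Rightarrow> 'a \<Rightarrow> 'a \<Rightarrow> 'a \<times> 'a \<times> 'a \<Rightarrow> 'a \<times> 'a \<times> 'a \<Rightarrow> 'a" where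
  "adj_bilinear a0 a1 a2 a3 a4 a5 =
     sym_bilinear (a2 * a4 - a3\<^sup>2) (a3 * a5 - a1 * a4) (a0 * a4 - a5\<^sup>2)
       (a1 * a5 - a0 * a3) (a0 * a2 - a1\<^sup>2) (a1 * a3 - a2 * a5)"

fun cross :: "'a::comm_ring_1 \<times> 'a \<times> 'a \<Rightarrow> 'a \<times> 'a \<times> 'a \<Rightarrow> 'a \<times> 'a \<times> 'a" where
  "cross (v1, v2, v3) (w1, w2, w3) = (v2 * w3 - v3 * w2, v3 * w1 - v1 * w3, v1 * w2 - v2 * w1)"

lemma vector_4:
  "(vector [x, y, z, w] :: 'a::zero ^ 4) $ 1 = x"
  "(vector [x, y, z, w] :: 'a::zero ^ 4) $ 2 = y"
  "(vector [x, y, z, w] :: 'a::zero ^ 4) $ 3 = z"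
  "(vector [x, y, z, w] :: 'a::zero ^ 4) $ 4 = w"
  unfolding vector_def by simp_all

lemma det_bordered:
  fixes z1 z2 z3 :: "'a::comm_ring_1"
  shows "det (vector
           [vector [0, z1, z2, z3],
            vector [z1, a0, a1, a5],
            vector [z2, a1, a2, a3],
            vector [z3, a5, a3, a4]] :: 'a ^ 4 ^ 4)
         = - adj_bilinear a0 a1 a2 a3 a4 a5 (z1, z2, z3) (z1, z2, z3)"
proof -
  have f1: "finite {2, 3, 4::4}" "1 \<notin> {2, 3, 4::4}" "finite {3, 4::4}" "2 \<notin> {3, 4::4}"
    "finite {4::4}" "3 \<notin> {4::4}" by auto
  show ?thesis
    unfolding det_def UNIV_4
    unfolding sum_over_permutations_insert[OF f1(1,2)] sum_over_permutations_insert[OF f1(3,4)]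
      sum_over_permutations_insert[OF f1(5,6)] permutes_sing
    by (simp add: sign_swap_id sign_compose permutation_swap_id vector_4 permutation_compose
          swap_id_eq transpose_def)
       (simp add: adj_bilinear_def sym_bilinear_def algebra_simps power2_eq_square)
qed

text \<open>
  The adjugate matrix is the second compound of the matrix, in the basis in which the second
  exterior power is given by the cross product; so it computes the Gram determinant of two vectors.
  Geometrically, the intersection point of two lines lies on a nondegenerate conic iff the two
  tangents of the conic in the line pencil of that point coincide.
\<close>

lemma adj_bilinear_cross:
  "adj_bilinear a0 a1 a2 a3 a4 a5 (cross v w) (cross v w) =
     sym_bilinear a0 a1 a2 a3 a4 a5 v v * sym_bilinear a0 a1 a2 a3 a4 a5 w w
     - (sym_bilinear a0 a1 a2 a3 a4 a5 v w)\<^sup>2"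
  by (cases v; cases w) (simp add: adj_bilinear_def sym_bilinear_def algebra_simps power2_eq_square)

text \<open>
  This is the previous identity for the adjugate matrix, because the adjugate of the adjugate of
  a matrix \<open>M\<close> of order three is \<open>det M \<cdot> M\<close>.
\<close>

lemma adj_bilinear_gram:
  "adj_bilinear a0 a1 a2 a3 a4 a5 v v * adj_bilinear a0 a1 a2 a3 a4 a5 w w
     - (adj_bilinear a0 a1 a2 a3 a4 a5 v w)\<^sup>2 =
   sym_det a0 a1 a2 a3 a4 a5 * sym_bilinear a0 a1 a2 a3 a4 a5 (cross v w) (cross v w)"
proof -
  obtain c1 c2 c3 where c: "cross v w = (c1, c2, c3)" by (cases "cross v w")
  show ?thesis
    unfolding adj_bilinear_def adj_bilinear_cross[symmetric]
    by (simp add: c adj_bilinear_def sym_bilinear_def sym_det_def algebra_simps power2_eq_square)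
qed

section \<open>The discriminants in the pencil parameter and in a Darboux coordinate\<close>

text \<open>
  The lines \<open>z1 x\<^sup>2 - 2 z2 x + z3 = 0\<close> are the tangents of \<open>conic2\<close>, parametrized as in the definition
  of the Darboux coordinates.
\<close>

definition tangent_line :: "'a::comm_ring_1 \<Rightarrow> 'a \<times> 'a \<times> 'a" where
  "tangent_line x = (x\<^sup>2, - 2 * x, 1)"

lemma discriminant2_quadratic: "discriminant2 [:c, b, a:] = b\<^sup>2 - 4 * a * c"
  by (simp add: discriminant2_def eval_nat_numeral)

text \<open>
  Here \<open>f\<close> is the point equation as a polynomial in the pencil parameter, and \<open>h\<close> stands for one half.
  Multiplication by \<open>4 (x1 - x2)\<^sup>2\<close>, which can be cancelled in an integral domain, replaces the point
  by the cross product of its two tangents and so makes \<open>adj_bilinear_cross\<close> applicable.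
\<close>

lemma discriminant_pencil_parameter:
  fixes a0 a1 a2 a3 a4 a5 x1 x2 h :: "'a::idom"
  assumes h: "2 * h = 1" and "x1 \<noteq> x2"
  defines "f \<equiv> - adj_bilinear [:a0:] [:a1:] [:a2, 1:] [:a3:] [:a4:] [:a5, - 2:]
                 (1, [:h * (x1 + x2):], [:x1 * x2:]) (1, [:h * (x1 + x2):], [:x1 * x2:])"
    and "T \<equiv> \<lambda>x. sym_bilinear a0 a1 a2 a3 a4 a5 (tangent_line x) (tangent_line x)"
  shows "degree f = 2" and "discriminant2 f = T x1 * T x2"
proof -
  let ?B = "sym_bilinear [:a0:] [:a1:] [:a2, 1:] [:a3:] [:a4:] [:a5, - 2:]"
  define g where "g = 2 * (x2 - x1)"
  define m where "m = sym_bilinear a0 a1 a2 a3 a4 a5 (tangent_line x1) (tangent_line x2)"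
  define n where "n = - 2 * (x1 - x2)\<^sup>2"
  define w where "w = (\<lambda>x::'a. ([:x\<^sup>2:], [:- 2 * x:], 1 :: 'a poly))"
  have two: "(2::'a) \<noteq> 0" using h by auto
  have "g * (h * (x1 + x2)) = (2 * h) * (x2\<^sup>2 - x1\<^sup>2)"
    by (simp add: g_def algebra_simps power2_eq_square)
  then have gh: "g * (h * (x1 + x2)) = x2\<^sup>2 - x1\<^sup>2" using h by simp
  have cr: "cross (w x1) (w x2) = ([:g:], [:g:] * [:h * (x1 + x2):], [:g:] * [:x1 * x2:])"
    by (simp add: gh gh[unfolded mult.commute[of g]] w_def) (simp add: g_def algebra_simps power2_eq_square)
  have "[:g\<^sup>2:] * f = - adj_bilinear [:a0:] [:a1:] [:a2, 1:] [:a3:] [:a4:] [:a5, - 2:]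
      (cross (w x1) (w x2)) (cross (w x1) (w x2))"
  proof -
    have hom: "adj_bilinear b0 b1 b2 b3 b4 b5 (k, k * y, k * z) (k, k * y, k * z) =
        (k * k) * adj_bilinear b0 b1 b2 b3 b4 b5 (1, y, z) (1, y, z)"
      for b0 b1 b2 b3 b4 b5 k y z :: "'a poly"
      by (simp add: adj_bilinear_def sym_bilinear_def algebra_simps)
    show ?thesis unfolding f_def cr hom by (simp add: power2_eq_square)
  qed
  also have "\<dots> = (?B (w x1) (w x2))\<^sup>2 - ?B (w x1) (w x1) * ?B (w x2) (w x2)"
    by (simp add: adj_bilinear_cross)
  \<comment> \<open>The form of the second conic vanishes on each of its tangents, so the pencil parameter survives
      only in the mixed term.\<close>
  also have "?B (w x1) (w x2) = [:m, n:]"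
    by (simp add: sym_bilinear_def w_def m_def n_def tangent_line_def one_pCons algebra_simps power2_eq_square)
  also have "?B (w x1) (w x1) = [:T x1:]"
    by (simp add: sym_bilinear_def w_def T_def tangent_line_def one_pCons algebra_simps power2_eq_square)
  also have "?B (w x2) (w x2) = [:T x2:]"
    by (simp add: sym_bilinear_def w_def T_def tangent_line_def one_pCons algebra_simps power2_eq_square)
  finally have "smult (g\<^sup>2) f = [:m, n:]\<^sup>2 - [:T x1:] * [:T x2:]" by simp
  also have "\<dots> = [:m\<^sup>2 - T x1 * T x2, 2 * m * n, n\<^sup>2:]"
    by (simp add: power2_eq_square)
  finally have eq: "smult (g\<^sup>2) f = [:m\<^sup>2 - T x1 * T x2, 2 * m * n, n\<^sup>2:]" .
  have n0: "n \<noteq> 0" and g0: "g \<noteq> 0" using two \<open>x1 \<noteq> x2\<close> by (auto simp: n_def g_def)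
  have "degree (smult (g\<^sup>2) f) = 2" unfolding eq using n0 by simp
  then show "degree f = 2" using g0 by simp
  have "(g\<^sup>2)\<^sup>2 * discriminant2 f = discriminant2 (smult (g\<^sup>2) f)"
    by (simp add: discriminant2_def algebra_simps power2_eq_square)
  also have "\<dots> = (2 * m * n)\<^sup>2 - 4 * n\<^sup>2 * (m\<^sup>2 - T x1 * T x2)"
    unfolding eq discriminant2_quadratic ..
  also have "\<dots> = (g\<^sup>2)\<^sup>2 * (T x1 * T x2)"
    by (simp add: n_def g_def algebra_simps power2_eq_square)
  finally show "discriminant2 f = T x1 * T x2" using g0 by simp
qed

lemma adj_bilinear_moving_point:
  fixes a0 a1 a2 a3 a4 a5 :: "'a::comm_ring_1"
  shows "adj_bilinear [:a0:] [:a1:] [:a2:] [:a3:] [:a4:] [:a5:]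
           ([:u1, v1:], [:u2, v2:], [:u3, v3:]) ([:u1, v1:], [:u2, v2:], [:u3, v3:]) =
         [:adj_bilinear a0 a1 a2 a3 a4 a5 (u1, u2, u3) (u1, u2, u3),
           2 * adj_bilinear a0 a1 a2 a3 a4 a5 (u1, u2, u3) (v1, v2, v3),
           adj_bilinear a0 a1 a2 a3 a4 a5 (v1, v2, v3) (v1, v2, v3):]"
  by (simp add: adj_bilinear_def sym_bilinear_def algebra_simps power2_eq_square)

text \<open>
  The conics of the pencil agree on the tangents of \<open>conic2\<close>, whose form contributes nothing there.
  This is why the polynomial \<open>P\<close> of the theorem is independent of the pencil parameter.
\<close>

lemma sym_bilinear_pencil_tangent_line:
  "sym_bilinear a0 a1 (a2 + s) a3 a4 (a5 - 2 * s) (tangent_line x) (tangent_line x) =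
   sym_bilinear a0 a1 a2 a3 a4 a5 (tangent_line x) (tangent_line x)"
  by (simp add: sym_bilinear_def tangent_line_def algebra_simps power2_eq_square)

text \<open>
  A point is an affine function of each of its Darboux coordinates. If one of them is \<open>x\<close>, then \<open>u\<close>
  is the point whose other coordinate is zero, and \<open>v\<close> is the one whose other coordinate is infinite.
\<close>

lemma adj_bilinear_darboux_line:
  fixes a0 a1 a2 a3 a4 a5 x h :: "'a::comm_ring_1"
  defines "u \<equiv> (1, h * x, 0)" and "v \<equiv> (0, h, x)"
  shows "- adj_bilinear [:a0:] [:a1:] [:a2:] [:a3:] [:a4:] [:a5:]
            (1, [:h * x, h:], [:0, x:]) (1, [:h * x, h:], [:0, x:])
         = [:- adj_bilinear a0 a1 a2 a3 a4 a5 u u,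
             - (2 * adj_bilinear a0 a1 a2 a3 a4 a5 u v),
             - adj_bilinear a0 a1 a2 a3 a4 a5 v v:]"
  using adj_bilinear_moving_point[of a0 a1 a2 a3 a4 a5 1 0 "h * x" h 0 x]
  by (simp add: u_def v_def one_pCons)

text \<open>
  The line on which the point moves is the tangent with parameter \<open>x\<close>; the factor 4 of the
  discriminant compensates for the cross product of the two chosen points being half of
  \<open>tangent_line x\<close>.
\<close>

lemma discriminant_darboux_coordinate:
  fixes a0 a1 a2 a3 a4 a5 x h :: "'a::comm_ring_1"
  assumes h: "2 * h = 1"
  shows "discriminant2 (- adj_bilinear [:a0:] [:a1:] [:a2:] [:a3:] [:a4:] [:a5:]
            (1, [:h * x, h:], [:0, x:]) (1, [:h * x, h:], [:0, x:]))
         = - sym_det a0 a1 a2 a3 a4 a5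
             * sym_bilinear a0 a1 a2 a3 a4 a5 (tangent_line x) (tangent_line x)"
proof -
  let ?Q = "adj_bilinear a0 a1 a2 a3 a4 a5" and ?T = "sym_bilinear a0 a1 a2 a3 a4 a5"
  define u where "u = (1::'a, h * x, 0::'a)"
  define v where "v = (0::'a, h, x)"
  have "cross u v = (h * x\<^sup>2, h * (- 2 * x), h * 1)"
    using h by (simp add: u_def v_def power2_eq_square flip: mult.assoc)
       (simp add: mult.commute h)
  then have "4 * ?T (cross u v) (cross u v) = (2 * h)\<^sup>2 * ?T (tangent_line x) (tangent_line x)"
    by (simp add: sym_bilinear_def tangent_line_def algebra_simps power2_eq_square)
  also have "\<dots> = ?T (tangent_line x) (tangent_line x)" using h by simp
  finally have cross: "4 * ?T (cross u v) (cross u v) = ?T (tangent_line x) (tangent_line x)" .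
  have "discriminant2 [:- ?Q u u, - (2 * ?Q u v), - ?Q v v:]
      = - 4 * (?Q u u * ?Q v v - (?Q u v)\<^sup>2)"
    by (simp add: discriminant2_quadratic algebra_simps power2_eq_square)
  also have "\<dots> = - sym_det a0 a1 a2 a3 a4 a5 * (4 * ?T (cross u v) (cross u v))"
    unfolding adj_bilinear_gram by simp
  finally show ?thesis
    unfolding cross by (simp only: adj_bilinear_darboux_line u_def v_def)
qed

section \<open>Substitution into a bivariate polynomial ring\<close>

text \<open>
  Substitution is a ring homomorphism in its first argument. So the polynomials \<open>P\<close> and \<open>J\<close> can be
  given as values of \<open>sym_bilinear\<close> and \<open>sym_det\<close> over a univariate polynomial ring, without
  writing out their coefficients.
\<close>

lemma subst2_pCons: "subst2 (pCons c p) x = [:[:c:]:] + x * subst2 p x"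
  by (simp add: subst2_def map_poly_pCons)

lemma subst2_0: "subst2 0 x = 0"
  by (simp add: subst2_def)

lemma subst2_add: "subst2 (p + q) x = subst2 p x + subst2 q x"
  by (induction p q rule: poly_induct2) (simp_all add: subst2_pCons subst2_0 algebra_simps)

lemma subst2_smult: "subst2 (smult c p) x = [:[:c:]:] * subst2 p x"
  by (induction p) (simp_all add: subst2_pCons subst2_0 algebra_simps)

lemma subst2_mult: "subst2 (p * q) x = subst2 p x * subst2 q x"
  by (induction p) (simp_all add: subst2_pCons subst2_0 subst2_add subst2_smult algebra_simps)

lemma subst2_const: "subst2 [:c:] x = [:[:c:]:]"
  by (simp add: subst2_pCons subst2_0)

lemma subst2_minus: "subst2 (- p) x = - subst2 p x"
  using subst2_add[of "- p" p x] by (simp add: subst2_0 eq_neg_iff_add_eq_0)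

lemma subst2_1: "subst2 1 x = 1"
  by (simp add: one_pCons subst2_const)

lemma subst2_numeral: "subst2 (numeral n) x = numeral n"
  by (simp add: numeral_poly subst2_const)

lemma subst2_monic_linear: "subst2 [:a, 1:] x = [:[:a:]:] + x"
proof -
  have "[:[:1::complex:]:] = 1" by (simp add: one_pCons)
  then show ?thesis by (simp only: subst2_pCons subst2_0 mult_1_right mult_zero_right add_0_right)
qed

lemma subst2_diff: "subst2 (p - q) x = subst2 p x - subst2 q x"
  using subst2_add[of p "- q" x] by (simp add: subst2_minus)

lemma subst2_sym_bilinear_tangent_line:
  "subst2 (sym_bilinear [:a0:] [:a1:] [:a2:] [:a3:] [:a4:] [:a5:]
             (tangent_line [:0, 1:]) (tangent_line [:0, 1:])) x =
   sym_bilinear [:[:a0:]:] [:[:a1:]:] [:[:a2:]:] [:[:a3:]:] [:[:a4:]:] [:[:a5:]:]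
     (tangent_line x) (tangent_line x)"
proof -
  have "subst2 [:0, 1:] x = x" by (simp add: subst2_monic_linear)
  then show ?thesis
    by (simp add: subst2_1 subst2_numeral subst2_diff sym_bilinear_def tangent_line_def power2_eq_square
        subst2_add subst2_mult subst2_minus subst2_const del: mult_pCons_left mult_pCons_right)
qed

lemma subst2_sym_det_pencil:
  "subst2 (sym_det [:a0:] [:a1:] [:a2, 1:] [:a3:] [:a4:] [:a5, - 2:]) x =
   sym_det [:[:a0:]:] [:[:a1:]:] ([:[:a2:]:] + x) [:[:a3:]:] [:[:a4:]:] ([:[:a5:]:] - 2 * x)"
proof -
  have "[:a5, - 2:] = [:a5:] - 2 * [:0, 1:]" by (simp add: numeral_poly)
  then have "subst2 [:a5, - 2:] x = [:[:a5:]:] - 2 * x"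
    by (simp only: subst2_diff subst2_mult subst2_numeral subst2_const subst2_monic_linear) simp
  then show ?thesis
    by (simp add: sym_det_def power2_eq_square subst2_add subst2_diff subst2_mult subst2_const
        subst2_monic_linear del: mult_pCons_left mult_pCons_right)
qed

section \<open>The point equation of the pencil\<close>

lemma point_equation_adj_bilinear:
  defines "Z \<equiv> \<lambda>x1 x2. (1, const3 (1/2) * (x1 + x2), x1 * x2)"
  shows "point_equation a0 a1 a2 a3 a4 a5 s x1 x2 =
    - adj_bilinear (const3 a0) (const3 a1) (const3 a2 + s) (const3 a3) (const3 a4)
        (const3 a5 - 2 * s) (Z x1 x2) (Z x1 x2)"
  unfolding point_equation_def Let_def det_bordered Z_def ..

theorem theorem1:
  fixes a0 a1 a2 a3 a4 a5 :: complex
  defines "F \<equiv> point_equation a0 a1 a2 a3 a4 a5"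
  assumes "general_position (conic1 a0 a1 a2 a3 a4 a5) conic2"
  shows "degree (F Y [:U:] [:V:]) = 2 \<and> degree (F [:U:] Y [:V:]) = 2 \<and> degree (F [:U:] [:V:] Y) = 2 \<and>
         F Y [:U:] [:V:] = F Y [:V:] [:U:] \<and>
         (\<exists>P :: complex poly.
            discriminant2 (F Y [:U:] [:V:]) = subst2 P U * subst2 P V \<and>
            (\<exists>J :: complex poly.
               discriminant2 (F [:U:] [:V:] Y) = subst2 J U * subst2 P V \<and>
               discriminant2 (F [:U:] Y [:V:]) = subst2 J U * subst2 P V))"
proof -
  define c :: "complex \<Rightarrow> complex poly poly" where "c = (\<lambda>a. [:[:a:]:])"
  define h where "h = c (1/2)"
  have h: "2 * h = 1" by (simp add: h_def c_def numeral_poly one_pCons)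
  have UV: "U \<noteq> V" by (simp add: U_def V_def)
  have sym: "F s x1 x2 = F s x2 x1" for s x1 x2
    by (simp add: F_def point_equation_def add.commute mult.commute)
  have F_s: "F Y [:U:] [:V:] =
      - adj_bilinear [:c a0:] [:c a1:] [:c a2, 1:] [:c a3:] [:c a4:] [:c a5, - 2:]
          (1, [:h * (U + V):], [:U * V:]) (1, [:h * (U + V):], [:U * V:])"
    by (simp add: F_def point_equation_adj_bilinear const3_def c_def h_def Y_def numeral_poly mult.commute)
  have F_x: "F [:U:] [:V:] Y =
      - adj_bilinear [:c a0:] [:c a1:] [:c a2 + U:] [:c a3:] [:c a4:] [:c a5 - 2 * U:]
          (1, [:h * V, h:], [:0, V:]) (1, [:h * V, h:], [:0, V:])"
    by (simp add: F_def point_equation_adj_bilinear const3_def c_def h_def Y_def numeral_poly mult.commute)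
  \<comment> \<open>The leading coefficient in the Darboux coordinate is seen not to vanish by setting the other
      Darboux coordinate to zero and looking at the square of the pencil parameter.\<close>
  have "adj_bilinear (c a0) (c a1) (c a2 + U) (c a3) (c a4) (c a5 - 2 * U) (0, h, V) (0, h, V) \<noteq> 0"
    (is "?q \<noteq> 0")
  proof
    assume "?q = 0"
    then have "coeff (poly ?q 0) 2 = 0" by simp
    moreover have "poly ?q 0 = [:(a0 * a4 - a5\<^sup>2) / 4, a5, - 1:]"
      by (simp add: adj_bilinear_def sym_bilinear_def c_def h_def U_def V_def power2_eq_square
          numeral_poly field_simps)
    ultimately show False by (simp add: eval_nat_numeral)
  qed
  then have deg_x: "degree (F [:U:] [:V:] Y) = 2"
    unfolding F_x adj_bilinear_darboux_line by simp
  define P where "P = sym_bilinear [:a0:] [:a1:] [:a2:] [:a3:] [:a4:] [:a5:]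
    (tangent_line [:0, 1:]) (tangent_line [:0, 1:])"
  define J where "J = - sym_det [:a0:] [:a1:] [:a2, 1:] [:a3:] [:a4:] [:a5, - 2:]"
  have P: "subst2 P x = sym_bilinear (c a0) (c a1) (c a2) (c a3) (c a4) (c a5)
      (tangent_line x) (tangent_line x)" for x
    unfolding P_def c_def by (rule subst2_sym_bilinear_tangent_line)
  have J: "subst2 J x =
      - sym_det (c a0) (c a1) (c a2 + x) (c a3) (c a4) (c a5 - 2 * x)" for x
    unfolding J_def c_def subst2_minus subst2_sym_det_pencil ..
  have "discriminant2 (F Y [:U:] [:V:]) = subst2 P U * subst2 P V"
    unfolding F_s P by (rule discriminant_pencil_parameter(2)[OF h UV])
  moreover have "discriminant2 (F [:U:] [:V:] Y) = subst2 J U * subst2 P V"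
    unfolding F_x discriminant_darboux_coordinate[OF h] sym_bilinear_pencil_tangent_line P J ..
  moreover have "degree (F Y [:U:] [:V:]) = 2"
    unfolding F_s by (rule discriminant_pencil_parameter(1)[OF h UV])
  ultimately show ?thesis
    using deg_x sym by metis
qed

end
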